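(* Let $X$ be a Banach space and let $S(t)$, $t\in\mathbb{R}$, be a well-posed continuous dynamical system on $X$. (1) If the flow $S(t)$ exhibits long-time strong instability near every point $\phi_0$ of some dense subset of $X$, then the set of initial data with unbounded orbits is generic in $X$ in the sense of Baire category (i.e. it is an intersection of countably many dense open sets); in particular it is nonempty. More precisely, the set $$\{\phi_0\in X:\ \sup_{t>0}\|S(t)\phi_0\|_X<\infty\}$$ is meager in $X$ (a countable union of nowhere dense sets). (2) Let $\mathcal{F}$ be a nonempty closed subset of $X$ and let $D\subset\mathcal{F}$ be dense in $\mathcal{F}$. Suppose that for every $\phi\in D$, $\delta>0$ and $K\geq 1$ there exists $\phi^*\in\mathcal{F}$ such that $\|\phi-\phi^*\|_X\leq\delta$ and $\sup_{t>0}\|S(t)\phi^*\|_X\geq K$. Then the set $\{\psi\in\mathcal{F}:\ \sup_{t\in\mathbb{R}}\|S(t)\psi\|_X=\infty\}$ is co-meager in $\mathcal{F}$ (in particular nonempty).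
   Context: A continuous dynamical system on $X$ is a family of maps $S(t):X\to X$, $t\in\mathbb{R}$, such that for every $x_0\in X$: $t\mapsto S(t)x_0$ belongs to $C([-T,T];X)$ for every $T>0$, $S(0)x_0=x_0$, and $S(t_1+t_2)x_0=S(t_1)S(t_2)x_0$ for all $t_1,t_2\in\mathbb{R}$. The maps are not assumed linear. The system is well-posed if for every $T>0$ the map $\phi\mapsto (t\mapsto S(t)\phi)$ is continuous from $X$ to $C([-T,T];X)$ (with the sup norm in $t$). The flow exhibits long-time strong instability near $\phi\in X$ if for every $0<\delta<1$ and $K\geq1$ there exists $\phi^*$ in the ball $B_X(\phi,\delta)$ of radius $\delta$ centered at $\phi$ such that $\sup_{t>0}\|S(t)\phi^*\|_X\geq K$. In part (1), the orbit of $\phi_0$ is called unbounded if $\sup_{t>0}\|S(t)\phi_0\|_X=\infty$. A set is co-meager in $\mathcal{F}$ if its complement in $\mathcal{F}$ is meager in the metric space $\mathcal{F}$. *)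

theory Defs
  imports "HOL-Analysis.Analysis"
begin

definition nowhere_dense_in :: "'a topology \<Rightarrow> 'a set \<Rightarrow> bool" where
  "nowhere_dense_in X N \<longleftrightarrow> N \<subseteq> topspace X \<and> X interior_of (X closure_of N) = {}"

definition meager_in :: "'a topology \<Rightarrow> 'a set \<Rightarrow> bool" where
  "meager_in X A \<longleftrightarrow>
     (\<exists>\<N>. countable \<N> \<and> (\<forall>N\<in>\<N>. nowhere_dense_in X N) \<and> A = \<Union>\<N>)"

definition comeager_in :: "'a topology \<Rightarrow> 'a set \<Rightarrow> bool" where
  "comeager_in X A \<longleftrightarrow> A \<subseteq> topspace X \<and> meager_in X (topspace X - A)"

text \<open>The argument order is \<open>S t x\<close>; the maps \<open>S t\<close> need not be linear.\<close>

definition continuous_dynamical_system :: "(real \<Rightarrow> 'a::real_normed_vector \<Rightarrow> 'a) \<Rightarrow> bool" where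
  "continuous_dynamical_system S \<longleftrightarrow>
     (\<forall>x. (\<forall>T>0. continuous_on {-T..T} (\<lambda>t. S t x)) \<and>
          S 0 x = x \<and>
          (\<forall>t1 t2. S (t1 + t2) x = S t1 (S t2 x)))"

text \<open>The library metric space \<^const>\<open>cfunspace\<close> over \<open>{-T..T}\<close>, with the sup metric, is
  \<open>C([-T,T];X)\<close>. Its elements are extensional functions, hence the restricted abstraction.\<close>

definition well_posed :: "(real \<Rightarrow> 'a::real_normed_vector \<Rightarrow> 'a) \<Rightarrow> bool" where
  "well_posed S \<longleftrightarrow>
     (\<forall>T>0. continuous_map euclidean
              (mtopology_of (cfunspace (top_of_set {-T..T}) euclidean_metric))
              (\<lambda>\<phi>. \<lambda>t\<in>{-T..T}. S t \<phi>))"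

text \<open>Suprema are taken in the extended reals, so that they may equal \<open>\<infinity>\<close>; on \<^typ>\<open>real\<close>
  the supremum of an unbounded set is unspecified.\<close>

definition sup_norm_on :: "real set \<Rightarrow> (real \<Rightarrow> 'a::real_normed_vector \<Rightarrow> 'a) \<Rightarrow> 'a \<Rightarrow> ereal" where
  "sup_norm_on I S \<phi> = (SUP t\<in>I. ereal (norm (S t \<phi>)))"

definition strong_instability_near ::
    "(real \<Rightarrow> 'a::real_normed_vector \<Rightarrow> 'a) \<Rightarrow> 'a \<Rightarrow> bool" where
  "strong_instability_near S \<phi> \<longleftrightarrow>
     (\<forall>\<delta> K. 0 < \<delta> \<and> \<delta> < 1 \<and> 1 \<le> K \<longrightarrow>
        (\<exists>\<phi>'\<in>ball \<phi> \<delta>. ereal K \<le> sup_norm_on {0<..} S \<phi>'))"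

end

theory Submission
  imports Defs
begin

text \<open>
  For a set \<open>I\<close> of times, \<open>sup_norm_on I S\<close> is a supremum of the continuous functions
  \<open>\<phi> \<mapsto> norm (S t \<phi>)\<close>, hence lower semicontinuous: its strict superlevel sets
  are open. The continuity of each single map \<open>S t\<close> comes from well-posedness, by composing
  \<open>\<phi> \<mapsto> (t \<mapsto> S t \<phi>)\<close> with evaluation at \<open>t\<close>.

  The instability hypothesis says that arbitrarily large values of this function occur
  arbitrarily close to a dense set of points, that is, that every superlevel set
  \<open>{\<phi>. n < sup_norm_on I S \<phi>}\<close> is dense. The unbounded orbits are
  the intersection of these open dense sets over all \<open>n\<close>, and the bounded ones
  are the union of their complements, which are closed with empty interior. Baire's theorem in
  the complete metric space \<open>X\<close> or \<open>\<F>\<close> shows that the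
  intersection is nonempty.

  Both parts are thus instances of one statement about lower semicontinuous functions: part (1)
  on the whole space with \<open>I\<close> the positive times, part (2) on \<open>\<F>\<close> with all
  times, where the supremum over positive times bounds the supremum over all times from below.
\<close>

text \<open>Evaluation at a point is 1-Lipschitz for the sup metric.\<close>

lemma continuous_map_cfunspace_eval:
  assumes "x \<in> topspace X"
  shows "continuous_map (mtopology_of (cfunspace X m)) (mtopology_of m) (\<lambda>f. f x)"
proof (rule Lipschitz_continuous_imp_continuous_map)
  have "mdist m (f x) (g x) \<le> 1 * mdist (cfunspace X m) f g"
    if "f \<in> mspace (cfunspace X m)" "g \<in> mspace (cfunspace X m)" for f g
    using cfunspace_mdist_le[OF that] assms by force
  moreover have "(\<lambda>f. f x) \<in> mspace (cfunspace X m) \<rightarrow> mspace m"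
    using assms by auto
  ultimately show "Lipschitz_continuous_map (cfunspace X m) m (\<lambda>f. f x)"
    unfolding Lipschitz_continuous_map_def by blast
qed

lemma well_posed_imp_continuous_on:
  fixes S :: "real \<Rightarrow> 'a::real_normed_vector \<Rightarrow> 'a"
  assumes "well_posed S"
  shows "continuous_on UNIV (S t)"
proof -
  define T where "T = \<bar>t\<bar> + 1"
  have t: "t \<in> {-T..T}" and "T > 0"
    by (auto simp: T_def)
  have "continuous_map euclidean (mtopology_of (cfunspace (top_of_set {-T..T}) euclidean_metric))
          (\<lambda>\<phi>. \<lambda>t\<in>{-T..T}. S t \<phi>)"
    using assms \<open>T > 0\<close> by (simp add: well_posed_def)
  moreover have "continuous_map (mtopology_of (cfunspace (top_of_set {-T..T}) euclidean_metric))
      (mtopology_of euclidean_metric) (\<lambda>f. f t :: 'a)"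
    using t by (intro continuous_map_cfunspace_eval) simp
  ultimately have "continuous_map euclidean (mtopology_of euclidean_metric)
      ((\<lambda>f. f t) \<circ> (\<lambda>\<phi>. \<lambda>t\<in>{-T..T}. S t \<phi>))"
    by (rule continuous_map_compose)
  moreover have "(\<lambda>f. f t) \<circ> (\<lambda>\<phi>. \<lambda>t\<in>{-T..T}. S t \<phi>) = S t"
    using t by (auto simp: fun_eq_iff)
  ultimately show ?thesis
    by simp
qed

lemma open_sup_norm_on_greater:
  assumes "\<And>t. t \<in> I \<Longrightarrow> continuous_on UNIV (S t)"
  shows "open {\<phi>. c < sup_norm_on I S \<phi>}"
proof -
  have "{\<phi>. c < sup_norm_on I S \<phi>} = (\<Union>t\<in>I. {\<phi>. c < ereal (norm (S t \<phi>))})"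
    by (auto simp: sup_norm_on_def less_SUP_iff)
  moreover have "open {\<phi>. c < ereal (norm (S t \<phi>))}" if "t \<in> I" for t
    using assms[OF that] by (intro open_Collect_less continuous_intros)
  ultimately show ?thesis
    by auto
qed

lemma ereal_eq_infinity_iff_greater_nat:
  fixes a :: ereal
  shows "a = \<infinity> \<longleftrightarrow> (\<forall>n::nat. ereal (real n) < a)"
proof
  assume *: "\<forall>n::nat. ereal (real n) < a"
  have "ereal B \<le> a" for B
    using * real_arch_simple[of B] by (meson ereal_less_eq(3) less_imp_le order_trans)
  then show "a = \<infinity>"
    by (rule ereal_top)
qed simp

text \<open>
  The complement in \<open>F\<close> of the superlevel set of height \<open>n\<close> is closed, and density
  of the superlevel set leaves it without interior; these complements exhaust the
  points where \<open>g\<close> is finite.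
\<close>

lemma lower_semicontinuous_infinite_generic:
  fixes g :: "'a \<Rightarrow> ereal"
  assumes X: "completely_metrizable_space X"
    and "topspace X \<noteq> {}"
    and lsc: "\<And>n::nat. openin X {x \<in> topspace X. ereal (real n) < g x}"
    and dense: "\<And>n::nat. X closure_of {x \<in> topspace X. ereal (real n) < g x} = topspace X"
  shows "comeager_in X {x \<in> topspace X. g x = \<infinity>}"
    and "{x \<in> topspace X. g x = \<infinity>} \<noteq> {}"
proof -
  define U where "U n = {x \<in> topspace X. ereal (real n) < g x}" for n :: nat
  have eq: "{x \<in> topspace X. g x = \<infinity>} = (\<Inter>n. U n)"
    by (auto simp: U_def ereal_eq_infinity_iff_greater_nat)
  have "nowhere_dense_in X (topspace X - U n)" for n
  proof -
    have "closedin X (topspace X - U n)"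
      using lsc by (auto simp: U_def)
    moreover have "X interior_of (topspace X - U n) = {}"
      using dense by (simp add: U_def interior_of_complement)
    ultimately show ?thesis
      by (simp add: nowhere_dense_in_def closure_of_closedin)
  qed
  moreover have "topspace X - (\<Inter>n. U n) = \<Union>(range (\<lambda>n. topspace X - U n))"
    by auto
  ultimately have "meager_in X (topspace X - (\<Inter>n. U n))"
    unfolding meager_in_def by (intro exI[of _ "range (\<lambda>n. topspace X - U n)"]) auto
  then show "comeager_in X {x \<in> topspace X. g x = \<infinity>}"
    unfolding comeager_in_def eq by (auto simp: U_def)
  have "X closure_of \<Inter>(range U) = topspace X"
    using lsc dense X by (intro Baire_category) (auto simp: U_def)
  then show "{x \<in> topspace X. g x = \<infinity>} \<noteq> {}"
    using \<open>topspace X \<noteq> {}\<close> eq by (metis closure_of_empty)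
qed

text \<open>
  A closure that contains \<open>D\<close> contains \<open>closure D\<close>, so it suffices to approximate the
  points of \<open>D\<close>, where the large values of \<open>g\<close> are found.
\<close>

lemma superlevel_set_dense:
  fixes g :: "'a::metric_space \<Rightarrow> ereal"
  assumes "F \<subseteq> closure D"
    and large: "\<And>x \<delta> K. x \<in> D \<Longrightarrow> 0 < \<delta> \<Longrightarrow> 1 \<le> K \<Longrightarrow> \<exists>y\<in>F. dist y x \<le> \<delta> \<and> ereal K \<le> g y"
  shows "F \<subseteq> closure {x \<in> F. ereal (real n) < g x}"
proof -
  have "x \<in> closure {x \<in> F. ereal (real n) < g x}" if "x \<in> D" for x
    unfolding closure_approachable
  proof (intro allI impI)
    fix e :: real
    assume "0 < e"
    \<comment> \<open>Height \<open>n + 1\<close> makes the inequality strict and meets the bound \<open>1 \<le> K\<close>.\<close>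
    then obtain y where y: "y \<in> F" "dist y x \<le> e / 2" "ereal (real n + 1) \<le> g y"
      using large[of x "e / 2" "real n + 1"] \<open>x \<in> D\<close> by auto
    have "ereal (real n) < ereal (real n + 1)"
      by simp
    also note y(3)
    finally have "ereal (real n) < g y" .
    with y \<open>0 < e\<close> show "\<exists>y\<in>{x \<in> F. ereal (real n) < g x}. dist y x < e"
      by (intro bexI[of _ y]) auto
  qed
  then show ?thesis
    using assms(1) closure_minimal[of D "closure {x \<in> F. ereal (real n) < g x}"] by auto
qed

lemma lower_semicontinuous_infinite_generic_closed:
  fixes g :: "'a::complete_space \<Rightarrow> ereal"
  assumes "closed F" "F \<noteq> {}"
    and lsc: "\<And>n::nat. open {x. ereal (real n) < g x}"
    and dense: "\<And>n::nat. F \<subseteq> closure {x \<in> F. ereal (real n) < g x}"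
  shows "comeager_in (top_of_set F) {x \<in> F. g x = \<infinity>}"
    and "{x \<in> F. g x = \<infinity>} \<noteq> {}"
proof -
  have "completely_metrizable_space (top_of_set F)"
    using \<open>closed F\<close> by (simp add: completely_metrizable_space_closedin
        completely_metrizable_space_euclidean)
  moreover have "openin (top_of_set F) {x \<in> F. ereal (real n) < g x}" for n :: nat
    using openin_open_Int[OF lsc, of F n] by (simp add: Int_def)
  moreover have "top_of_set F closure_of {x \<in> F. ereal (real n) < g x} = F" for n :: nat
    using dense[of n] by (auto simp: closure_of_subtopology Int_absorb1)
  ultimately show "comeager_in (top_of_set F) {x \<in> F. g x = \<infinity>}"
    and "{x \<in> F. g x = \<infinity>} \<noteq> {}"
    using lower_semicontinuous_infinite_generic[of "top_of_set F" g] \<open>F \<noteq> {}\<close> by auto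
qed

theorem proposition1p3:
  fixes S :: "real \<Rightarrow> 'a::banach \<Rightarrow> 'a"
  assumes "continuous_dynamical_system S"
    and "well_posed S"
  shows
    "((\<exists>D. closure D = UNIV \<and> (\<forall>\<phi>\<in>D. strong_instability_near S \<phi>)) \<longrightarrow>
        (\<exists>\<U>. countable \<U> \<and> (\<forall>U\<in>\<U>. open U \<and> closure U = UNIV) \<and>
              {\<phi>. sup_norm_on {0<..} S \<phi> = \<infinity>} = \<Inter>\<U>) \<and>
        {\<phi>. sup_norm_on {0<..} S \<phi> = \<infinity>} \<noteq> {} \<and>
        meager_in euclidean {\<phi>. sup_norm_on {0<..} S \<phi> < \<infinity>})
     \<and>
     (\<forall>F D. closed F \<and> F \<noteq> {} \<and> D \<subseteq> F \<and> F \<subseteq> closure D \<and>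
        (\<forall>\<phi>\<in>D. \<forall>\<delta>>0. \<forall>K\<ge>1. \<exists>\<phi>'\<in>F.
            norm (\<phi> - \<phi>') \<le> \<delta> \<and> ereal K \<le> sup_norm_on {0<..} S \<phi>') \<longrightarrow>
        comeager_in (top_of_set F) {\<psi>\<in>F. sup_norm_on UNIV S \<psi> = \<infinity>} \<and>
        {\<psi>\<in>F. sup_norm_on UNIV S \<psi> = \<infinity>} \<noteq> {})"
proof -
  have lsc: "open {\<phi>. c < sup_norm_on I S \<phi>}" for c I
    using well_posed_imp_continuous_on[OF assms(2)] by (intro open_sup_norm_on_greater)

  have part1:
    "(\<exists>\<U>. countable \<U> \<and> (\<forall>U\<in>\<U>. open U \<and> closure U = UNIV) \<and>
        {\<phi>. sup_norm_on {0<..} S \<phi> = \<infinity>} = \<Inter>\<U>) \<and>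
     {\<phi>. sup_norm_on {0<..} S \<phi> = \<infinity>} \<noteq> {} \<and>
     meager_in euclidean {\<phi>. sup_norm_on {0<..} S \<phi> < \<infinity>}"
    if "closure D = UNIV" and D: "\<And>\<phi>. \<phi> \<in> D \<Longrightarrow> strong_instability_near S \<phi>" for D
  proof -
    define U where "U n = {\<phi>. ereal (real n) < sup_norm_on {0<..} S \<phi>}" for n :: nat
    have near: "\<exists>\<psi>\<in>UNIV. dist \<psi> \<phi> \<le> \<delta> \<and> ereal K \<le> sup_norm_on {0<..} S \<psi>"
      if "\<phi> \<in> D" "0 < \<delta>" "1 \<le> K" for \<phi> \<delta> K
    proof -
      \<comment> \<open>Strong instability speaks only of radii below 1.\<close>
      have "0 < min \<delta> (1/2)" "min \<delta> (1/2) < 1"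
        using \<open>0 < \<delta>\<close> by auto
      then obtain \<psi> where "\<psi> \<in> ball \<phi> (min \<delta> (1/2))" "ereal K \<le> sup_norm_on {0<..} S \<psi>"
        using D[OF \<open>\<phi> \<in> D\<close>] \<open>1 \<le> K\<close> unfolding strong_instability_near_def by blast
      then show ?thesis
        by (intro bexI[of _ \<psi>]) (auto simp: dist_commute)
    qed
    have dense: "UNIV \<subseteq> closure {\<phi> \<in> UNIV. ereal (real n) < sup_norm_on {0<..} S \<phi>}" for n :: nat
      using \<open>closure D = UNIV\<close> near by (intro superlevel_set_dense[of UNIV D]) auto
    note generic = lower_semicontinuous_infinite_generic_closed[OF closed_UNIV UNIV_not_empty lsc dense]
    have "{\<phi>. sup_norm_on {0<..} S \<phi> = \<infinity>} = \<Inter>(range U)"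
      by (auto simp: U_def ereal_eq_infinity_iff_greater_nat)
    moreover have "\<forall>V\<in>range U. open V \<and> closure V = UNIV"
      using lsc dense by (auto simp: U_def)
    ultimately have "\<exists>\<U>. countable \<U> \<and> (\<forall>V\<in>\<U>. open V \<and> closure V = UNIV) \<and>
        {\<phi>. sup_norm_on {0<..} S \<phi> = \<infinity>} = \<Inter>\<U>"
      by (intro exI[of _ "range U"]) simp
    moreover have "UNIV - {\<phi>. sup_norm_on {0<..} S \<phi> = \<infinity>} = {\<phi>. sup_norm_on {0<..} S \<phi> < \<infinity>}"
      by auto
    ultimately show ?thesis
      using generic by (simp add: comeager_in_def)
  qed

  have part2:
    "comeager_in (top_of_set F) {\<psi>\<in>F. sup_norm_on UNIV S \<psi> = \<infinity>} \<and>
     {\<psi>\<in>F. sup_norm_on UNIV S \<psi> = \<infinity>} \<noteq> {}"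
    if F: "closed F" "F \<noteq> {}" "F \<subseteq> closure D"
      and near: "\<forall>\<phi>\<in>D. \<forall>\<delta>>0. \<forall>K\<ge>1. \<exists>\<phi>'\<in>F.
            norm (\<phi> - \<phi>') \<le> \<delta> \<and> ereal K \<le> sup_norm_on {0<..} S \<phi>'" for F D
  proof -
    have le: "sup_norm_on {0<..} S \<phi> \<le> sup_norm_on UNIV S \<phi>" for \<phi>
      unfolding sup_norm_on_def by (intro SUP_subset_mono) auto
    have "\<exists>\<psi>\<in>F. dist \<psi> \<phi> \<le> \<delta> \<and> ereal K \<le> sup_norm_on UNIV S \<psi>"
      if "\<phi> \<in> D" "0 < \<delta>" "1 \<le> K" for \<phi> \<delta> K
      using near that le by (metis dist_commute dist_norm order_trans)
    then have "F \<subseteq> closure {\<phi> \<in> F. ereal (real n) < sup_norm_on UNIV S \<phi>}" for n :: nat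
      by (rule superlevel_set_dense[OF F(3)])
    then show ?thesis
      using lower_semicontinuous_infinite_generic_closed[OF F(1,2) lsc] by blast
  qed

  show ?thesis
  proof (intro conjI[OF impI allI[OF allI[OF impI]]])
    assume "\<exists>D. closure D = UNIV \<and> (\<forall>\<phi>\<in>D. strong_instability_near S \<phi>)"
    then obtain D where "closure D = UNIV" "\<And>\<phi>. \<phi> \<in> D \<Longrightarrow> strong_instability_near S \<phi>"
      by auto
    then show "(\<exists>\<U>. countable \<U> \<and> (\<forall>U\<in>\<U>. open U \<and> closure U = UNIV) \<and>
              {\<phi>. sup_norm_on {0<..} S \<phi> = \<infinity>} = \<Inter>\<U>) \<and>
        {\<phi>. sup_norm_on {0<..} S \<phi> = \<infinity>} \<noteq> {} \<and>
        meager_in euclidean {\<phi>. sup_norm_on {0<..} S \<phi> < \<infinity>}"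
      by (rule part1)
  qed (elim conjE, rule part2)
qed

end
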